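(* Let $G=(V,E)$, $V=\{1,\dots,n\}$, be a weakly connected directed acyclic graph (DAG) with at least one edge. Suppose the graph is known and all nodes are excited. Let $\mathcal N^m\subseteq V$ be the set of measured nodes. Then the network $G$ is identifiable in the class $\mathcal F_{Z,NL}$ if and only if all the sinks of $G$ are measured, i.e. every sink belongs to $\mathcal N^m$. Moreover, identifiability remains true when only restricted data are used: if all sinks belong to $\mathcal N^m$ and $\{f\},\{\tilde f\}$ are two sets of edge functions in $\mathcal F_{Z,NL}$ on $G$, with corresponding functions $F_i,\tilde F_i$, then each of the following two conditions separately implies $\{f\}=\{\tilde f\}$: (1) (zero initial conditions, constant excitations) $F_i(0,\mathbf u,t)=\tilde F_i(0,\mathbf u,t)$ for all $i\in\mathcal N^m$, all constant excitation signals $\mathbf u\in\mathbb R^n$ and all $t\ge 0$; (2) (multiple initial conditions, zero excitations) $F_i(\mathbf x^0,0,t)=\tilde F_i(\mathbf x^0,0,t)$ for all $i\in\mathcal N^m$, all $\mathbf x^0\in\mathbb R^n$ and all $t\ge 0$.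
   Context: Network model. $G=(V,E)$ is a weakly connected digraph with $V=\{1,\dots,n\}$. The notation $(i,j)\in E$ means that there is an edge from $j$ to $i$, and $\mathcal N_i=\{j:(i,j)\in E\}$ is the set of in-neighbors of $i$. Each node has a scalar state $x_i\in\mathbb R$ evolving by $$\dot x_i(t)=\sum_{j\in\mathcal N_i}f_{i,j}(x_j(t))+u_i(t),\qquad x_i(0)=x_i^0,$$ where $f_{i,j}:\mathbb R\to\mathbb R$ is the function of edge $(i,j)$ and $u_i$ is an external excitation signal. Graph known: $G$ is known and $(i,j)\in E$ implies $f_{i,j}\not\equiv 0$; every candidate set of edge functions is indexed by the same $E$. Full excitation: every node $i$ has an input $u_i$ that can be chosen freely (in a fixed class of locally integrable signals $[0,\infty)\to\mathbb R$ containing all constant signals). Initial conditions $\mathbf x^0=(x_1^0,\dots,x_n^0)\in\mathbb R^n$ are also freely chosen variables. Functions $F_i$. For a set of edge functions $\{f\}=\{f_{i,j}:(i,j)\in E\}$, $F_i$ denotes the map giving the state of node $i$: $x_i(t)=F_i(\mathbf x^0,\mathbf u,t)$, as a function of initial conditions, excitation signals on $[0,t]$, and time $t\ge0$. Measuring node $i$ means knowing $F_i$. For a set $\mathcal N^m\subseteq V$ of measured nodes, $F(\mathcal N^m)=(F_i)_{i\in\mathcal N^m}$ is the family of measured functions generated by $\{f\}$; $\tilde F(\mathcal N^m)$ is the one generated by another set $\{\tilde f\}$. Identifiability. The network $G$ is identifiable in a class $\mathcal F$ (with measured nodes $\mathcal N^m$) if for every set $\{f\}=\{f_{i,j}\in\mathcal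 F:(i,j)\in E\}$ and every set $\{\tilde f\}=\{\tilde f_{i,j}\in\mathcal F:(i,j)\in E\}$, the equality $F(\mathcal N^m)=\tilde F(\mathcal N^m)$ implies $\{f\}=\{\tilde f\}$, i.e. $f_{i,j}=\tilde f_{i,j}$ for all $(i,j)\in E$. Class $\mathcal F_{Z,NL}$ (pure nonlinear functions): functions $f:\mathbb R\to\mathbb R$ that are real analytic on $\mathbb R$, satisfy $f(0)=0$, and whose Taylor series at $0$, $f(x)=\sum_{n=1}^\infty a_nx^n$, contains at least one coefficient $a_n\ne0$ with $n>1$. A sink is a node with no outgoing edge. *)

theory Defs
  imports "HOL-Analysis.Analysis"
begin

section \<open>Digraphs\<close>

text \<open>
  A digraph is a finite vertex set \<open>V\<close> with a relation \<open>E \<subseteq> V \<times> V\<close>, where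
  \<open>(i, j) \<in> E\<close> is an edge from \<open>j\<close> \<^emph>\<open>to\<close> \<open>i\<close>.
\<close>

definition in_neighbors :: "(nat \<times> nat) set \<Rightarrow> nat \<Rightarrow> nat set" where
  "in_neighbors E i = {j. (i, j) \<in> E}"

definition weakly_connected :: "nat set \<Rightarrow> (nat \<times> nat) set \<Rightarrow> bool" where
  "weakly_connected V E \<longleftrightarrow> (\<forall>i\<in>V. \<forall>j\<in>V. (i, j) \<in> (E \<union> E\<inverse>)\<^sup>*)"

definition sinks :: "nat set \<Rightarrow> (nat \<times> nat) set \<Rightarrow> nat set" where
  "sinks V E = {j \<in> V. \<not> (\<exists>i. (i, j) \<in> E)}"


section \<open>Edge functions\<close>

definition real_analytic :: "(real \<Rightarrow> real) \<Rightarrow> bool" where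
  "real_analytic f \<longleftrightarrow> (\<forall>c. \<exists>A. (\<lambda>h. f (c + h)) has_fps_expansion A)"

definition F_ZNL :: "(real \<Rightarrow> real) set" where
  "F_ZNL = {f. real_analytic f \<and> f 0 = 0 \<and>
               (\<exists>A. f has_fps_expansion A \<and> (\<exists>n>1. fps_nth A n \<noteq> 0))}"

text \<open>
  A family of edge functions is \<open>f :: nat \<Rightarrow> nat \<Rightarrow> real \<Rightarrow> real\<close>; only the values \<open>f i j\<close> with
  \<open>(i, j) \<in> E\<close> carry meaning, so families are compared on \<open>E\<close> only.
\<close>

definition edge_families ::
    "(nat \<times> nat) set \<Rightarrow> (real \<Rightarrow> real) set \<Rightarrow> (nat \<Rightarrow> nat \<Rightarrow> real \<Rightarrow> real) set" where
  "edge_families E \<F> = {f. \<forall>(i, j)\<in>E. f i j \<in> \<F>}"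

definition same_edge_functions ::
    "(nat \<times> nat) set \<Rightarrow> (nat \<Rightarrow> nat \<Rightarrow> real \<Rightarrow> real) \<Rightarrow> (nat \<Rightarrow> nat \<Rightarrow> real \<Rightarrow> real) \<Rightarrow> bool" where
  "same_edge_functions E f g \<longleftrightarrow> (\<forall>(i, j)\<in>E. f i j = g i j)"


section \<open>Dynamics\<close>

text \<open>
  Signals on \<open>[0, \<infinity>)\<close> are functions \<open>real \<Rightarrow> real\<close> whose values at negative times are irrelevant.
\<close>

definition locally_integrable :: "(real \<Rightarrow> real) \<Rightarrow> bool" where
  "locally_integrable u \<longleftrightarrow> (\<forall>T\<ge>0. u absolutely_integrable_on {0..T})"

definition admissible_signals :: "(real \<Rightarrow> real) set \<Rightarrow> bool" where
  "admissible_signals U \<longleftrightarrow> (\<forall>u\<in>U. locally_integrable u) \<and> (\<forall>c. (\<lambda>t. c) \<in> U)"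

text \<open>
  Excitations are merely locally integrable, so the differential equation is understood in the
  sense of Caratheodory, i.e. through the equivalent integral equation.
\<close>

definition is_solution ::
    "nat set \<Rightarrow> (nat \<times> nat) set \<Rightarrow> (nat \<Rightarrow> nat \<Rightarrow> real \<Rightarrow> real) \<Rightarrow>
     (nat \<Rightarrow> real) \<Rightarrow> (nat \<Rightarrow> real \<Rightarrow> real) \<Rightarrow> (nat \<Rightarrow> real \<Rightarrow> real) \<Rightarrow> bool" where
  "is_solution V E f x0 u x \<longleftrightarrow>
     (\<forall>i\<in>V. continuous_on {0..} (x i) \<and>
       (\<forall>t\<ge>0. ((\<lambda>s. (\<Sum>j\<in>in_neighbors E i. f i j (x j s)) + u i s)
                  has_integral (x i t - x0 i)) {0..t}))"

text \<open>
  The map \<open>F\<^sub>i\<close>: the state of node \<open>i\<close> at time \<open>t\<close>. The description is meaningful when a global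
  solution exists and is unique on \<open>V\<close> at nonnegative times, which is proved for acyclic graphs in
  \<open>dag_solution_exists\<close> and \<open>node_state_eq\<close> below.
\<close>

definition node_state ::
    "nat set \<Rightarrow> (nat \<times> nat) set \<Rightarrow> (nat \<Rightarrow> nat \<Rightarrow> real \<Rightarrow> real) \<Rightarrow>
     nat \<Rightarrow> (nat \<Rightarrow> real) \<Rightarrow> (nat \<Rightarrow> real \<Rightarrow> real) \<Rightarrow> real \<Rightarrow> real" where
  "node_state V E f i x0 u t = (THE y. \<exists>x. is_solution V E f x0 u x \<and> y = x i t)"


section \<open>Identifiability\<close>

definition same_measurements ::
    "nat set \<Rightarrow> (nat \<times> nat) set \<Rightarrow> (real \<Rightarrow> real) set \<Rightarrow> nat set \<Rightarrow>
     (nat \<Rightarrow> nat \<Rightarrow> real \<Rightarrow> real) \<Rightarrow> (nat \<Rightarrow> nat \<Rightarrow> real \<Rightarrow> real) \<Rightarrow> bool" where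
  "same_measurements V E U M f g \<longleftrightarrow>
     (\<forall>i\<in>M. \<forall>x0 u. (\<forall>k\<in>V. u k \<in> U) \<longrightarrow>
        (\<forall>t\<ge>0. node_state V E f i x0 u t = node_state V E g i x0 u t))"

definition identifiable ::
    "nat set \<Rightarrow> (nat \<times> nat) set \<Rightarrow> (real \<Rightarrow> real) set \<Rightarrow> (real \<Rightarrow> real) set \<Rightarrow> nat set \<Rightarrow> bool" where
  "identifiable V E U \<F> M \<longleftrightarrow>
     (\<forall>f\<in>edge_families E \<F>. \<forall>g\<in>edge_families E \<F>.
        same_measurements V E U M f g \<longrightarrow> same_edge_functions E f g)"


section \<open>Well-posedness on acyclic graphs\<close>

lemma real_analytic_continuous:
  assumes "real_analytic f"
  shows "continuous_on UNIV f"
proof -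
  have "isCont f c" for c
  proof -
    obtain A where "(\<lambda>h. f (c + h)) has_fps_expansion A"
      using assms unfolding real_analytic_def by blast
    hence "isCont (\<lambda>h. f (c + h)) 0"
      by (rule has_fps_expansion_imp_continuous)
    thus ?thesis
      unfolding isCont_def by (subst LIM_offset_zero_iff[where a = c]) (simp_all)
  qed
  thus ?thesis by (simp add: continuous_at_imp_continuous_on)
qed

lemma F_ZNL_continuous: "f \<in> F_ZNL \<Longrightarrow> continuous_on UNIV f"
  by (simp add: F_ZNL_def real_analytic_continuous)

lemma dag_solution_unique:
  assumes V: "finite V" "E \<subseteq> V \<times> V" "acyclic E"
    and x: "is_solution V E f x0 u x" and y: "is_solution V E f x0 u y"
    and "i \<in> V" "t \<ge> 0"
  shows "x i t = y i t"
proof -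
  have "finite E" using V finite_subset by blast
  hence "wf (E\<inverse>)" using V(3) by (rule finite_acyclic_wf_converse)
  hence "i \<in> V \<longrightarrow> (\<forall>t\<ge>0. x i t = y i t)"
  proof (induction i rule: wf_induct_rule)
    case (less i)
    show ?case
    proof (intro impI allI)
      fix t :: real assume i: "i \<in> V" and t: "t \<ge> 0"
      have eq: "x j s = y j s" if "j \<in> in_neighbors E i" "s \<in> {0..t}" for j s
        using less that V(2) by (auto simp: in_neighbors_def)
      have "((\<lambda>s. (\<Sum>j\<in>in_neighbors E i. f i j (x j s)) + u i s)
                  has_integral (x i t - x0 i)) {0..t}"
        using x i t by (auto simp: is_solution_def)
      moreover have "((\<lambda>s. (\<Sum>j\<in>in_neighbors E i. f i j (x j s)) + u i s)
                  has_integral (y i t - x0 i)) {0..t}"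
      proof (rule has_integral_eq)
        show "((\<lambda>s. (\<Sum>j\<in>in_neighbors E i. f i j (y j s)) + u i s)
                  has_integral (y i t - x0 i)) {0..t}"
          using y i t by (auto simp: is_solution_def)
      qed (simp add: eq)
      ultimately show "x i t = y i t"
        by (metis has_integral_unique diff_add_cancel)
    qed
  qed
  thus ?thesis using \<open>i \<in> V\<close> \<open>t \<ge> 0\<close> by simp
qed

lemma dag_solution_exists:
  assumes V: "finite V" "E \<subseteq> V \<times> V" "acyclic E"
    and f: "\<forall>(i, j)\<in>E. continuous_on UNIV (f i j)"
    and u: "\<forall>i\<in>V. locally_integrable (u i)"
  shows "\<exists>x. is_solution V E f x0 u x"
proof -
  have "finite E" using V finite_subset by blast
  hence wf: "wf (E\<inverse>)" using V(3) by (rule finite_acyclic_wf_converse)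
  define H where "H = (\<lambda>(x :: nat \<Rightarrow> real \<Rightarrow> real) i t.
    x0 i + integral {0..t} (\<lambda>s. (\<Sum>j\<in>in_neighbors E i. f i j (x j s)) + u i s))"
  define x where "x = wfrec (E\<inverse>) H"
  have x_eq: "x i t =
      x0 i + integral {0..t} (\<lambda>s. (\<Sum>j\<in>in_neighbors E i. f i j (x j s)) + u i s)" for i t
  proof -
    have "x i = H (cut x (E\<inverse>) i) i"
      unfolding x_def by (rule wfrec[OF wf])
    also have "\<dots> = H x i"
      unfolding H_def
      by (intro ext arg_cong2[of _ _ _ _ "(+)"] arg_cong2[of _ _ _ _ integral] refl sum.cong)
         (simp_all add: in_neighbors_def cut_apply)
    finally show ?thesis by (simp add: H_def)
  qed
  have integrable: "(\<lambda>s. (\<Sum>j\<in>in_neighbors E i. f i j (x j s)) + u i s) integrable_on {0..T}"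
    if i: "i \<in> V" and c: "\<forall>j\<in>in_neighbors E i. continuous_on {0..} (x j)" and T: "T \<ge> 0" for i T
  proof (rule integrable_add)
    show "u i integrable_on {0..T}"
      using u i T by (auto simp: locally_integrable_def dest: set_lebesgue_integral_eq_integral)
    have "continuous_on {0..T} (\<lambda>s. f i j (x j s))" if j: "j \<in> in_neighbors E i" for j
    proof (rule continuous_on_compose2[where t = UNIV and g = "f i j" and f = "x j"])
      show "continuous_on UNIV (f i j)" using f j by (auto simp: in_neighbors_def)
      show "continuous_on {0..T} (x j)"
        using c j by (auto intro: continuous_on_subset)
    qed simp
    thus "(\<lambda>s. \<Sum>j\<in>in_neighbors E i. f i j (x j s)) integrable_on {0..T}"
      by (intro integrable_continuous_real continuous_on_sum) auto
  qed
  have cont: "i \<in> V \<longrightarrow> continuous_on {0..} (x i)" for i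
    using wf
  proof (induction i rule: wf_induct_rule)
    case (less i)
    show ?case
    proof
      assume i: "i \<in> V"
      have c: "\<forall>j\<in>in_neighbors E i. continuous_on {0..} (x j)"
        using less V(2) by (auto simp: in_neighbors_def)
      have contT: "continuous_on {0..T} (x i)" if "T \<ge> 0" for T
        unfolding x_eq[of i, abs_def]
        by (intro continuous_intros indefinite_integral_continuous_1 integrable i c that)
      show "continuous_on {0..} (x i)"
        unfolding continuous_on_eq_continuous_within
      proof
        fix t :: real assume t: "t \<in> {0..}"
        have "continuous (at t within {0..t+1}) (x i)"
          using contT[of "t + 1"] t by (simp add: continuous_on_eq_continuous_within)
        moreover have "at t within {0..t+1} = at t within {0..}"
          by (rule at_within_nhd[where S = "{..<t+1}"]) auto
        ultimately show "continuous (at t within {0..}) (x i)" by simp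
      qed
    qed
  qed
  have "is_solution V E f x0 u x"
    unfolding is_solution_def
  proof (intro ballI conjI allI impI)
    fix i and t :: real assume i: "i \<in> V" and t: "t \<ge> 0"
    have "\<forall>j\<in>in_neighbors E i. continuous_on {0..} (x j)"
      using cont V(2) by (auto simp: in_neighbors_def)
    from integrable_integral[OF integrable[OF i this t]]
    show "((\<lambda>s. (\<Sum>j\<in>in_neighbors E i. f i j (x j s)) + u i s)
             has_integral (x i t - x0 i)) {0..t}"
      by (simp add: x_eq[of i t])
  qed (use cont in auto)
  thus ?thesis by blast
qed

lemma node_state_eq:
  assumes "finite V" "E \<subseteq> V \<times> V" "acyclic E"
    and "is_solution V E f x0 u x" "i \<in> V" "t \<ge> 0"
  shows "node_state V E f i x0 u t = x i t"
  unfolding node_state_def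
proof (rule the_equality)
  show "\<exists>y. is_solution V E f x0 u y \<and> x i t = y i t"
    using assms(4) by (intro exI[of _ x]) simp
next
  fix z assume "\<exists>y. is_solution V E f x0 u y \<and> z = y i t"
  then obtain y where "is_solution V E f x0 u y" "z = y i t" by (elim exE conjE)
  thus "z = x i t"
    using dag_solution_unique[OF assms(1-3) _ assms(4-6)] by simp
qed

end

theory Submission
  imports Defs "HOL-Complex_Analysis.Cauchy_Integral_Formula"
begin

text \<open>
  Both kinds of restricted data drive node \<open>i\<close> by one free parameter \<open>a i\<close>: its state is
  \<open>(\<alpha> + \<beta> t) a i\<close> plus a term that depends only on the parameters of its strict ancestors. Suppose that
  \<open>f\<close> and \<open>g\<close> give node \<open>i\<close> the same state. Differentiating, the sums of \<open>f i j (x j)\<close> and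
  \<open>g i j (y j)\<close> over the in-neighbours \<open>j\<close> agree. Take \<open>j\<close> with no descendant among the other
  in-neighbours. Setting all parameters but \<open>a j\<close> to zero gives \<open>f i j = g i j\<close>. Varying \<open>a j\<close> alone
  then shows that \<open>b \<mapsto> f i j (b + \<delta> t) - f i j b\<close> is constant, where \<open>\<delta> = x j - y j\<close> is continuous and
  \<open>\<delta> 0 = 0\<close>. If \<open>\<delta>\<close> were not zero, \<open>f i j\<close> would be additive for small increments, hence linear. So
  \<open>x j = y j\<close>, the terms of \<open>j\<close> cancel, and the next in-neighbour can be treated. Equality of states thus
  propagates backwards along edges, from the sinks to all nodes. Conversely, an edge into an unmeasured
  sink influences no measured node.
\<close>

section \<open>Functions of the class \<open>F_ZNL\<close>\<close>

lemma F_ZNL_zero: "f \<in> F_ZNL \<Longrightarrow> f 0 = 0"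
  by (simp add: F_ZNL_def)

lemma edge_families_memD: "f \<in> edge_families E F \<Longrightarrow> (i, j) \<in> E \<Longrightarrow> f i j \<in> F"
  by (auto simp: edge_families_def)

text \<open>Different scalings give distinct members of the class, used in the counterexample for an
  unmeasured sink.\<close>

lemma F_ZNL_scaled_square:
  assumes "c \<noteq> 0"
  shows "(\<lambda>x. c * x ^ 2) \<in> F_ZNL"
proof -
  have "(\<lambda>h. c * (b + h) ^ 2) has_fps_expansion
      fps_const c * ((fps_const b + fps_X) * (fps_const b + fps_X))" for b
    unfolding power2_eq_square by (intro fps_expansion_intros)
  hence 1: "real_analytic (\<lambda>x. c * x ^ 2)"
    unfolding real_analytic_def by blast
  have "(\<lambda>x. c * x ^ 2) has_fps_expansion fps_const c * fps_X ^ 2"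
    by (intro fps_expansion_intros)
  moreover have "fps_nth (fps_const c * fps_X ^ 2) 2 \<noteq> 0"
    using assms by simp
  ultimately show ?thesis
    using 1 unfolding F_ZNL_def by (auto intro!: exI[of _ "2::nat"])
qed

text \<open>Comparing Taylor coefficients at 0 in the doubling identity gives
  \<open>fps_nth A n * (2 ^ n - 2) = 0\<close>, which kills every coefficient with
  \<open>n > 1\<close>.\<close>

lemma F_ZNL_not_doubling:
  assumes f: "f \<in> F_ZNL" and r: "0 < r" and dbl: "\<And>x. \<bar>x\<bar> < r \<Longrightarrow> f (2 * x) = 2 * f x"
  shows False
proof -
  obtain A m where A: "f has_fps_expansion A" and m: "m > 1" "fps_nth A m \<noteq> 0"
    using f by (auto simp: F_ZNL_def)
  have "eventually (\<lambda>z. z \<in> eball 0 (fps_conv_radius A)) (nhds 0)"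
    using A by (intro eventually_nhds_in_open) (auto simp: has_fps_expansion_def zero_ereal_def)
  moreover have "eventually (\<lambda>z. eval_fps A z = f z) (nhds 0)"
    using A by (simp add: has_fps_expansion_def)
  ultimately have "eventually (\<lambda>z. (\<lambda>n. fps_nth A n * z ^ n) sums f z) (nhds 0)"
  proof eventually_elim
    case (elim z)
    thus ?case using sums_eval_fps[of z A] by (simp add: in_eball_iff)
  qed
  then obtain d where d: "d > 0" and sf: "\<And>z. \<bar>z\<bar> < d \<Longrightarrow> (\<lambda>n. fps_nth A n * z ^ n) sums f z"
    by (auto simp: eventually_nhds_metric dist_real_def)
  \<comment> \<open>Halving \<open>d\<close> keeps \<open>2 * z\<close> where the series represents
    \<open>f\<close>.\<close>
  define e where "e = min r (d / 2)"
  define a where "a n = fps_nth A n * (2 ^ n - 2)" for n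
  have "(\<lambda>n. a n * (z - 0) ^ n) sums 0" if "norm (z - 0) < e" for z
  proof -
    have "\<bar>z\<bar> < r" "\<bar>2 * z\<bar> < d" "\<bar>z\<bar> < d"
      using that by (auto simp: e_def)
    hence "(\<lambda>n. fps_nth A n * (2 * z) ^ n - 2 * (fps_nth A n * z ^ n)) sums (f (2 * z) - 2 * f z)"
      by (intro sums_diff sums_mult sf)
    thus ?thesis
      using dbl[OF \<open>\<bar>z\<bar> < r\<close>] by (simp add: a_def algebra_simps power_mult_distrib)
  qed
  moreover have "a m \<noteq> 0"
  proof -
    have "(2::real) ^ 1 < 2 ^ m" using m(1) by (intro power_strict_increasing) auto
    thus ?thesis using m(2) by (simp add: a_def)
  qed
  moreover have "0 < e" using r d by (simp add: e_def)
  \<comment> \<open>Zeros of a nontrivial power series are isolated, yet this one sums to 0 near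
    0.\<close>
  ultimately obtain s where "0 < s" "\<And>z::real. z \<in> cball 0 s - {0} \<Longrightarrow> (0::real) \<noteq> 0"
    using powser_0_nonzero[of e 0 a "\<lambda>_. 0" m] m(1) by auto
  from this(2)[of s] \<open>0 < s\<close> show False by simp
qed

text \<open>
  If \<open>\<delta> T \<noteq> 0\<close>, then \<open>\<delta>\<close> takes all values between \<open>0\<close> and \<open>\<delta> T\<close>, so \<open>f\<close> is additive for all small
  increments.
\<close>

lemma F_ZNL_shift_eq_zero:
  fixes \<delta> :: "real \<Rightarrow> real"
  assumes f: "f \<in> F_ZNL" and T: "0 \<le> T" and \<delta>: "continuous_on {0..T} \<delta>" "\<delta> 0 = 0"
    and shift: "\<And>t b. 0 < t \<Longrightarrow> t \<le> T \<Longrightarrow> f (b + \<delta> t) - f b = C t"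
  shows "\<delta> T = 0"
proof (rule ccontr)
  assume nz: "\<delta> T \<noteq> 0"
  note f0 = F_ZNL_zero[OF f]
  have add: "f (b + d) = f b + f d" if d: "d \<in> closed_segment 0 (\<delta> T)" for b d
  proof -
    obtain t where t: "t \<in> {0..T}" "\<delta> t = d"
      using ivt_increasing_component_on_1[of 0 T \<delta> 1 d] ivt_decreasing_component_on_1[of 0 T \<delta> 1 d]
        T \<delta> d by (auto simp: closed_segment_eq_real_ivl split: if_splits)
    show ?thesis
    proof (cases "t = 0")
      case True
      thus ?thesis using t \<delta>(2) f0 by simp
    next
      case False
      thus ?thesis using shift[of t b] shift[of t 0] t f0 by simp
    qed
  qed
  have "f (2 * x) = 2 * f x" if x: "\<bar>x\<bar> < \<bar>\<delta> T\<bar>" for x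
  proof (cases "x \<in> closed_segment 0 (\<delta> T)")
    case True
    thus ?thesis using add[of x x] by simp
  next
    case False
    \<comment> \<open>The increment \<open>- x\<close> at the base points \<open>2 * x\<close> and
      \<open>x\<close> gives \<open>f x = f (2 * x) + f (- x)\<close> and
      \<open>0 = f x + f (- x)\<close>.\<close>
    hence "- x \<in> closed_segment 0 (\<delta> T)"
      using x by (auto simp: closed_segment_eq_real_ivl split: if_splits)
    from add[OF this, of "2 * x"] add[OF this, of x] show ?thesis
      using f0 by simp
  qed
  thus False using F_ZNL_not_doubling[OF f] nz by (metis zero_less_abs_iff)
qed

section \<open>Integral equations on the half-line\<close>

lemma continuous_zero_if_indefinite_integral_zero:
  fixes h :: "real \<Rightarrow> real"
  assumes h: "continuous_on {0..} h" and int: "\<And>t. 0 \<le> t \<Longrightarrow> (h has_integral 0) {0..t}"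
    and t: "0 \<le> t"
  shows "h t = 0"
proof -
  \<comment> \<open>Ending the interval at \<open>t + 1\<close> keeps it nondegenerate at
    \<open>t = 0\<close>, so derivatives are unique.\<close>
  have "((\<lambda>u. integral {0..u} h) has_vector_derivative h t) (at t within {0..t + 1})"
    using h t by (intro integral_has_vector_derivative) (auto intro: continuous_on_subset)
  hence "((\<lambda>u. 0) has_vector_derivative h t) (at t within {0..t + 1})"
    by (rule has_vector_derivative_transform[rotated 2]) (use t int in \<open>auto simp: integral_unique\<close>)
  moreover have "((\<lambda>u. 0::real) has_vector_derivative 0) (at t within {0..t + 1})"
    by simp
  ultimately show ?thesis
    using vector_derivative_unique_within_closed_interval[of 0 "t + 1" t "\<lambda>u. 0" "h t" 0] t by simp
qed

text \<open>
  \<open>A\<close> is closed under in-neighbours, so the subsystem on \<open>A\<close> evolves independently of the rest.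
\<close>

lemma solutions_agree_on_closed_set:
  assumes V: "finite V" "E \<subseteq> V \<times> V" "acyclic E"
    and x: "is_solution V E f x0 u x" and y: "is_solution V E g y0 v y"
    and closed: "\<And>k l. k \<in> A \<Longrightarrow> (k, l) \<in> E \<Longrightarrow> l \<in> A"
    and fg: "\<And>k l. k \<in> A \<Longrightarrow> (k, l) \<in> E \<Longrightarrow> f k l = g k l"
    and init: "\<And>k. k \<in> A \<Longrightarrow> x0 k = y0 k" and input: "\<And>k. k \<in> A \<Longrightarrow> u k = v k"
    and "i \<in> A" "i \<in> V" "0 \<le> t"
  shows "x i t = y i t"
proof -
  have "finite E" using V finite_subset by blast
  hence "wf (E\<inverse>)" using V(3) by (rule finite_acyclic_wf_converse)
  hence "i \<in> A \<longrightarrow> i \<in> V \<longrightarrow> (\<forall>t\<ge>0. x i t = y i t)"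
  proof (induction i rule: wf_induct_rule)
    case (less i)
    show ?case
    proof (intro impI allI)
      fix t :: real assume iA: "i \<in> A" and i: "i \<in> V" and t: "0 \<le> t"
      have eq: "f i j (x j s) = g i j (y j s)" if "j \<in> in_neighbors E i" "s \<in> {0..t}" for j s
        using less that V(2) iA closed fg by (auto simp: in_neighbors_def)
      have "((\<lambda>s. (\<Sum>j\<in>in_neighbors E i. f i j (x j s)) + u i s)
                  has_integral (x i t - x0 i)) {0..t}"
        using x i t by (auto simp: is_solution_def)
      moreover have "((\<lambda>s. (\<Sum>j\<in>in_neighbors E i. f i j (x j s)) + u i s)
                  has_integral (y i t - y0 i)) {0..t}"
      proof (rule has_integral_eq)
        show "((\<lambda>s. (\<Sum>j\<in>in_neighbors E i. g i j (y j s)) + v i s)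
                  has_integral (y i t - y0 i)) {0..t}"
          using y i t by (auto simp: is_solution_def)
      qed (simp add: eq input[OF iA])
      ultimately show "x i t = y i t"
        using init[OF iA] by (metis has_integral_unique diff_add_cancel)
    qed
  qed
  thus ?thesis using assms by blast
qed

section \<open>States driven by one parameter per node\<close>

text \<open>
  \<open>\<alpha> = 1, \<beta> = 0\<close> gives free initial conditions without excitation; \<open>\<alpha> = 0, \<beta> = 1\<close> gives constant
  excitations from zero initial conditions.
\<close>

definition probed_state ::
    "nat set \<Rightarrow> (nat \<times> nat) set \<Rightarrow> real \<Rightarrow> real \<Rightarrow> (nat \<Rightarrow> nat \<Rightarrow> real \<Rightarrow> real) \<Rightarrow>
     (nat \<Rightarrow> real) \<Rightarrow> nat \<Rightarrow> real \<Rightarrow> real" where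
  "probed_state V E \<alpha> \<beta> f a i t = node_state V E f i (\<lambda>k. \<alpha> * a k) (\<lambda>k s. \<beta> * a k) t"

text \<open>The normalisation makes the weight \<open>\<alpha> + \<beta> * t\<close> equal to 1 at
  \<open>t = 1\<close>; with nonnegativity it is positive for \<open>t > 0\<close>.\<close>

locale probed_dag =
  fixes V :: "nat set" and E :: "(nat \<times> nat) set" and \<alpha> \<beta> :: real
  assumes finite_V: "finite V" and E_subset: "E \<subseteq> V \<times> V" and acyclic: "acyclic E"
    and nonneg: "0 \<le> \<alpha>" "0 \<le> \<beta>" and sum_one: "\<alpha> + \<beta> = 1"
begin

abbreviation "X \<equiv> probed_state V E \<alpha> \<beta>"

lemma finite_E: "finite E"
  using finite_V E_subset finite_subset by blast

lemma weight_pos: "0 < t \<Longrightarrow> 0 < \<alpha> + \<beta> * t"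
  using nonneg sum_one by (cases "\<alpha> = 0") (auto simp: add_pos_nonneg)

lemma probed_state_solution:
  assumes f: "f \<in> edge_families E F_ZNL"
  obtains x where "is_solution V E f (\<lambda>k. \<alpha> * a k) (\<lambda>k s. \<beta> * a k) x"
    and "\<And>i t. i \<in> V \<Longrightarrow> 0 \<le> t \<Longrightarrow> X f a i t = x i t"
proof -
  have "\<exists>x. is_solution V E f (\<lambda>k. \<alpha> * a k) (\<lambda>k s. \<beta> * a k) x"
  proof (rule dag_solution_exists[OF finite_V E_subset acyclic])
    show "\<forall>(i, j)\<in>E. continuous_on UNIV (f i j)"
      using edge_families_memD[OF f] F_ZNL_continuous by blast
    show "\<forall>i\<in>V. locally_integrable (\<lambda>s. \<beta> * a i)"
      by (simp add: locally_integrable_def absolutely_integrable_on_const)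
  qed
  then obtain x where x: "is_solution V E f (\<lambda>k. \<alpha> * a k) (\<lambda>k s. \<beta> * a k) x" by blast
  show ?thesis
    using that[OF x] node_state_eq[OF finite_V E_subset acyclic x]
    by (simp add: probed_state_def)
qed

lemma continuous_on_probed_state:
  assumes "f \<in> edge_families E F_ZNL" "i \<in> V"
  shows "continuous_on {0..} (X f a i)"
proof -
  obtain x where x: "is_solution V E f (\<lambda>k. \<alpha> * a k) (\<lambda>k s. \<beta> * a k) x"
    and eq: "\<And>i t. i \<in> V \<Longrightarrow> 0 \<le> t \<Longrightarrow> X f a i t = x i t"
    by (rule probed_state_solution[OF assms(1), where a = a]) blast
  have "continuous_on {0..} (x i)" using x assms(2) by (simp add: is_solution_def)
  thus ?thesis by (rule continuous_on_eq) (use eq assms(2) in auto)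
qed

lemma probed_state_has_integral:
  assumes f: "f \<in> edge_families E F_ZNL" and i: "i \<in> V" and t: "0 \<le> t"
  shows "((\<lambda>s. \<Sum>j\<in>in_neighbors E i. f i j (X f a j s))
            has_integral (X f a i t - (\<alpha> + \<beta> * t) * a i)) {0..t}"
proof -
  obtain x where x: "is_solution V E f (\<lambda>k. \<alpha> * a k) (\<lambda>k s. \<beta> * a k) x"
    and eq: "\<And>i t. i \<in> V \<Longrightarrow> 0 \<le> t \<Longrightarrow> X f a i t = x i t"
    by (rule probed_state_solution[OF f, where a = a]) blast
  have "((\<lambda>s. (\<Sum>j\<in>in_neighbors E i. f i j (x j s)) + \<beta> * a i)
            has_integral (x i t - \<alpha> * a i)) {0..t}"
    using x i t by (auto simp: is_solution_def)
  from has_integral_diff[OF this has_integral_const_real[of "\<beta> * a i" 0 t]]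
  have "((\<lambda>s. \<Sum>j\<in>in_neighbors E i. f i j (x j s))
            has_integral (x i t - (\<alpha> + \<beta> * t) * a i)) {0..t}"
    using t by (simp add: algebra_simps)
  hence "((\<lambda>s. \<Sum>j\<in>in_neighbors E i. f i j (X f a j s))
            has_integral (x i t - (\<alpha> + \<beta> * t) * a i)) {0..t}"
    by (rule has_integral_eq[rotated])
       (use E_subset eq in \<open>force simp: in_neighbors_def intro!: sum.cong\<close>)
  thus ?thesis using eq i t by simp
qed

lemma probed_state_initial:
  assumes "f \<in> edge_families E F_ZNL" "i \<in> V"
  shows "X f a i 0 = \<alpha> * a i"
  using has_integral_unique[OF probed_state_has_integral[OF assms order_refl, where a = a,
        unfolded atLeastAtMost_singleton] has_integral_refl(2)]
  by simp

text \<open>Later \<open>A\<close> is the set of non-descendants of a node \<open>j\<close>, so that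
  varying \<open>a j\<close> alone leaves the states on \<open>A\<close> unchanged.\<close>

lemma probed_state_cong:
  assumes f: "f \<in> edge_families E F_ZNL"
    and closed: "\<And>k l. k \<in> A \<Longrightarrow> (k, l) \<in> E \<Longrightarrow> l \<in> A"
    and ab: "\<And>k. k \<in> A \<Longrightarrow> a k = b k" and "i \<in> A" "i \<in> V" "0 \<le> t"
  shows "X f a i t = X f b i t"
proof -
  obtain x where x: "is_solution V E f (\<lambda>k. \<alpha> * a k) (\<lambda>k s. \<beta> * a k) x"
    and xeq: "\<And>i t. i \<in> V \<Longrightarrow> 0 \<le> t \<Longrightarrow> X f a i t = x i t"
    by (rule probed_state_solution[OF f, where a = a]) blast
  obtain y where y: "is_solution V E f (\<lambda>k. \<alpha> * b k) (\<lambda>k s. \<beta> * b k) y"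
    and yeq: "\<And>i t. i \<in> V \<Longrightarrow> 0 \<le> t \<Longrightarrow> X f b i t = y i t"
    by (rule probed_state_solution[OF f, where a = b]) blast
  have "x i t = y i t"
    by (rule solutions_agree_on_closed_set[OF finite_V E_subset acyclic x y, of A])
       (use assms in auto)
  thus ?thesis using xeq yeq assms by simp
qed

text \<open>The in-neighbour sums coincide for \<open>a\<close> and \<open>b\<close>, so only the
  explicit term of \<open>i\<close> differs; \<open>i\<close> itself may lie outside
  \<open>A\<close>.\<close>

lemma probed_state_shift:
  assumes f: "f \<in> edge_families E F_ZNL"
    and closed: "\<And>k l. k \<in> A \<Longrightarrow> (k, l) \<in> E \<Longrightarrow> l \<in> A"
    and ab: "\<And>k. k \<in> A \<Longrightarrow> a k = b k" and nbrs: "in_neighbors E i \<subseteq> A" and i: "i \<in> V" and t: "0 \<le> t"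
  shows "X f a i t = X f b i t + (\<alpha> + \<beta> * t) * (a i - b i)"
proof -
  have "((\<lambda>s. \<Sum>j\<in>in_neighbors E i. f i j (X f a j s))
            has_integral (X f b i t - (\<alpha> + \<beta> * t) * b i)) {0..t}"
  proof (rule has_integral_eq[OF _ probed_state_has_integral[OF f i t]])
    fix s assume "s \<in> {0..t}"
    thus "(\<Sum>j\<in>in_neighbors E i. f i j (X f b j s)) = (\<Sum>j\<in>in_neighbors E i. f i j (X f a j s))"
      using nbrs E_subset probed_state_cong[OF f closed ab]
      by (intro sum.cong refl) (force simp: in_neighbors_def)
  qed
  from has_integral_unique[OF this probed_state_has_integral[OF f i t]]
  show ?thesis by (simp add: algebra_simps)
qed

lemma probed_state_zero:
  assumes f: "f \<in> edge_families E F_ZNL" and "i \<in> V" "0 \<le> t"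
  shows "X f (\<lambda>k. 0) i t = 0"
proof -
  have "f i j 0 = 0" if "j \<in> in_neighbors E i" for i j
    using edge_families_memD[OF f] F_ZNL_zero that by (auto simp: in_neighbors_def)
  hence "is_solution V E f (\<lambda>k. \<alpha> * 0) (\<lambda>k s. \<beta> * 0) (\<lambda>i t. 0)"
    by (simp add: is_solution_def)
  thus ?thesis
    unfolding probed_state_def
    using node_state_eq[OF finite_V E_subset acyclic _ assms(2,3)] by fastforce
qed

section \<open>Identification from sums over in-neighbours\<close>

text \<open>
  A node \<open>j \<in> S\<close> with no descendant in \<open>S\<close> can be moved by its own parameter without affecting the
  other summands. This identifies first its edge function (all other parameters being zero) and
  then its state, after which the summand of \<open>j\<close> can be cancelled.
\<close>

lemma identify_summands:
  assumes f: "f \<in> edge_families E F_ZNL" and g: "g \<in> edge_families E F_ZNL"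
    and "S \<subseteq> V" and "\<And>j. j \<in> S \<Longrightarrow> \<phi> j \<in> F_ZNL" and "\<And>j. j \<in> S \<Longrightarrow> \<psi> j \<in> F_ZNL"
    and "\<And>a t. 0 \<le> t \<Longrightarrow> (\<Sum>j\<in>S. \<phi> j (X f a j t)) = (\<Sum>j\<in>S. \<psi> j (X g a j t))"
  shows "\<forall>j\<in>S. \<phi> j = \<psi> j \<and> (\<forall>a. \<forall>t\<ge>0. X f a j t = X g a j t)"
proof -
  have "finite S" using assms(3) finite_V finite_subset by blast
  thus ?thesis using assms(3-6)
  proof (induction S rule: finite_psubset_induct)
    case (psubset S)
    note SV = psubset.prems(1) and \<phi> = psubset.prems(2) and \<psi> = psubset.prems(3)
      and sums = psubset.prems(4)
    show ?case
    proof (cases "S = {}")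
      case False
      have "wf (E\<^sup>+)"
        using finite_E acyclic by (intro wf_trancl finite_acyclic_wf)
      \<comment> \<open>As \<open>(k, j) \<in> E\<close> leads from \<open>j\<close> to
        \<open>k\<close>, a minimal \<open>j\<close> has no descendant in \<open>S\<close>.\<close>
      then obtain j where j: "j \<in> S" and max: "\<And>k. (k, j) \<in> E\<^sup>+ \<Longrightarrow> k \<notin> S"
        using False by (metis ex_in_conv wf_eq_minimal)
      \<comment> \<open>The non-descendants of \<open>j\<close>; reflexivity excludes
        \<open>j\<close> itself.\<close>
      define A where "A = {k. (k, j) \<notin> E\<^sup>*}"
      have closed: "l \<in> A" if "k \<in> A" "(k, l) \<in> E" for k l
        using that by (auto simp: A_def intro: converse_rtrancl_into_rtrancl)
      have SA: "k \<in> A" if "k \<in> S - {j}" for k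
        using that max by (auto simp: A_def rtrancl_eq_or_trancl)
      have jA: "k \<noteq> j" if "k \<in> A" for k using that by (auto simp: A_def)
      have nbrs: "in_neighbors E j \<subseteq> A"
        using acyclic by (auto simp: A_def in_neighbors_def acyclic_def dest: rtrancl_into_trancl2)
      have jV: "j \<in> V" using j SV by blast
      have split: "sum h S = h j + sum h (S - {j})" for h :: "nat \<Rightarrow> real"
        using psubset.hyps(1) j by (simp add: sum.remove)
      have others: "X h a k t = X h b k t"
        if "h \<in> edge_families E F_ZNL" "\<And>k. k \<noteq> j \<Longrightarrow> a k = b k" "k \<in> S - {j}" "0 \<le> t" for h a b k t
      proof (rule probed_state_cong[OF that(1), of A])
        show "a i = b i" if "i \<in> A" for i
          using jA[OF that] \<open>\<And>k. k \<noteq> j \<Longrightarrow> a k = b k\<close> by blast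
        show "k \<in> A" by (rule SA[OF that(3)])
        show "k \<in> V" using that(3) SV by blast
        show "l \<in> A" if "i \<in> A" "(i, l) \<in> E" for i l by (rule closed[OF that])
      qed (rule that(4))
      have own: "X h a j t = X h b j t + (\<alpha> + \<beta> * t) * (a j - b j)"
        if "h \<in> edge_families E F_ZNL" "\<And>k. k \<noteq> j \<Longrightarrow> a k = b k" "0 \<le> t" for h a b t
      proof (rule probed_state_shift[OF that(1), of A])
        show "a i = b i" if "i \<in> A" for i
          using jA[OF that] \<open>\<And>k. k \<noteq> j \<Longrightarrow> a k = b k\<close> by blast
        show "l \<in> A" if "i \<in> A" "(i, l) \<in> E" for i l by (rule closed[OF that])
      qed (rule nbrs jV that(3))+

      have \<phi>\<psi>: "\<phi> j = \<psi> j"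
      proof
        fix y
        \<comment> \<open>At time 1 the weight is 1, so node \<open>j\<close> is exactly at
          \<open>y\<close> in both systems while the rest of \<open>S\<close> is at 0.\<close>
        define a where "a = (\<lambda>k::nat. 0::real)(j := y)"
        have zeros: "X h a k 1 = 0" if "h \<in> edge_families E F_ZNL" "k \<in> S - {j}" for h k
          using others[of h a "\<lambda>k. 0" k 1] probed_state_zero[of h k 1] that SV by (auto simp: a_def)
        have y: "X h a j 1 = y" if "h \<in> edge_families E F_ZNL" for h
          using own[of h a "\<lambda>k. 0" 1] probed_state_zero[of h j 1] that jV sum_one by (auto simp: a_def)
        have "\<phi> j y + (\<Sum>k\<in>S - {j}. \<phi> k (X f a k 1)) = \<psi> j y + (\<Sum>k\<in>S - {j}. \<psi> k (X g a k 1))"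
          using sums[of 1 a] unfolding split by (simp add: y f g)
        moreover have "(\<Sum>k\<in>S - {j}. \<phi> k (X f a k 1)) = 0"
          using \<phi> by (intro sum.neutral) (auto simp: zeros[OF f] F_ZNL_zero)
        moreover have "(\<Sum>k\<in>S - {j}. \<psi> k (X g a k 1)) = 0"
          using \<psi> by (intro sum.neutral) (auto simp: zeros[OF g] F_ZNL_zero)
        ultimately show "\<phi> j y = \<psi> j y" by simp
      qed

      have states: "X f a j T = X g a j T" if T: "0 \<le> T" for a T
      proof -
        define \<delta> where "\<delta> t = X f a j t - X g a j t" for t
        \<comment> \<open>The other summands do not depend on \<open>a j\<close>, hence not on
          \<open>b\<close> below.\<close>
        define C where "C t = (\<Sum>k\<in>S - {j}. \<psi> k (X g a k t)) - (\<Sum>k\<in>S - {j}. \<phi> k (X f a k t))" for t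
        have "\<delta> T = 0"
        proof (rule F_ZNL_shift_eq_zero[OF \<phi>[OF j] T])
          have "continuous_on {0..} \<delta>"
            unfolding \<delta>_def[abs_def] by (intro continuous_on_diff continuous_on_probed_state f g jV)
          thus "continuous_on {0..T} \<delta>" by (rule continuous_on_subset) auto
          show "\<delta> 0 = 0" by (simp add: \<delta>_def probed_state_initial f g jV)
          fix t b :: real assume t: "0 < t" "t \<le> T"
          \<comment> \<open>This choice puts the \<open>g\<close>-state of \<open>j\<close> at
            \<open>b\<close> at time \<open>t\<close>; the \<open>f\<close>-state moves by the same
            amount, to \<open>b + \<delta> t\<close>.\<close>
          define a' where "a' = a(j := a j + (b - X g a j t) / (\<alpha> + \<beta> * t))"
          have off_j: "a' k = a k" if "k \<noteq> j" for k
            using that by (simp add: a'_def)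
          have "(\<alpha> + \<beta> * t) * (a' j - a j) = b - X g a j t"
            using weight_pos[OF t(1)] unfolding a'_def by simp
          hence a': "X h a' j t = X h a j t + (b - X g a j t)" if "h \<in> edge_families E F_ZNL" for h
            using own[of h a' a t] that off_j t(1) by simp
          have rest: "X h a' k t = X h a k t" if "h \<in> edge_families E F_ZNL" "k \<in> S - {j}" for h k
            using others[of h a' a k t] that off_j t(1) by simp
          have "X f a' j t = b + \<delta> t" "X g a' j t = b"
            by (simp_all add: a'[OF f] a'[OF g] \<delta>_def)
          hence "\<phi> j (b + \<delta> t) + (\<Sum>k\<in>S - {j}. \<phi> k (X f a k t)) =
                \<psi> j b + (\<Sum>k\<in>S - {j}. \<psi> k (X g a k t))"
            using sums[of t a'] t(1) unfolding split by (simp add: rest f g)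
          thus "\<phi> j (b + \<delta> t) - \<phi> j b = C t" by (simp add: C_def \<phi>\<psi>)
        qed
        thus ?thesis by (simp add: \<delta>_def)
      qed

      have "\<forall>k\<in>S - {j}. \<phi> k = \<psi> k \<and> (\<forall>a. \<forall>t\<ge>0. X f a k t = X g a k t)"
      proof (rule psubset.IH)
        fix a and t :: real assume "0 \<le> t"
        thus "(\<Sum>k\<in>S - {j}. \<phi> k (X f a k t)) = (\<Sum>k\<in>S - {j}. \<psi> k (X g a k t))"
          using sums[of t a] unfolding split by (simp add: \<phi>\<psi> states)
      qed (use j SV \<phi> \<psi> in auto)
      thus ?thesis using \<phi>\<psi> states by blast
    qed simp
  qed
qed

text \<open>Equal states give the two in-neighbour sums equal integrals over every
  \<open>{0..t}\<close>; by continuity the sums themselves agree.\<close>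

lemma identify_in_neighbors:
  assumes f: "f \<in> edge_families E F_ZNL" and g: "g \<in> edge_families E F_ZNL" and i: "i \<in> V"
    and meas: "\<And>a t. 0 \<le> t \<Longrightarrow> X f a i t = X g a i t"
  shows "\<forall>j\<in>in_neighbors E i. f i j = g i j \<and> (\<forall>a. \<forall>t\<ge>0. X f a j t = X g a j t)"
proof (rule identify_summands[OF f g])
  show NV: "in_neighbors E i \<subseteq> V" using E_subset by (auto simp: in_neighbors_def)
  show fi: "f i j \<in> F_ZNL" and gi: "g i j \<in> F_ZNL" if "j \<in> in_neighbors E i" for j
    using edge_families_memD f g that by (auto simp: in_neighbors_def)
  fix a and t :: real assume t: "0 \<le> t"
  define h where "h s = (\<Sum>j\<in>in_neighbors E i. f i j (X f a j s)) -
    (\<Sum>j\<in>in_neighbors E i. g i j (X g a j s))" for s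
  have "h t = 0"
  proof (rule continuous_zero_if_indefinite_integral_zero[OF _ _ t])
    have comp: "continuous_on {0..} (\<lambda>s. p (X q a j s))"
      if "p \<in> F_ZNL" "q \<in> edge_families E F_ZNL" "j \<in> in_neighbors E i" for p q j
      by (rule continuous_on_compose2[OF F_ZNL_continuous[OF that(1)] continuous_on_probed_state])
         (use that NV in auto)
    show "continuous_on {0..} h"
      unfolding h_def by (intro continuous_on_diff continuous_on_sum comp fi gi f g)
    show "(h has_integral 0) {0..r}" if "0 \<le> r" for r
      using has_integral_diff[OF probed_state_has_integral[OF f i that, of a]
          probed_state_has_integral[OF g i that, of a]] meas[OF that]
      by (simp add: h_def[abs_def])
  qed
  thus "(\<Sum>j\<in>in_neighbors E i. f i j (X f a j t)) = (\<Sum>j\<in>in_neighbors E i. g i j (X g a j t))"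
    by (simp add: h_def)
qed

text \<open>Induction along \<open>E\<close> runs backwards from the sinks: a non-sink is an
  in-neighbour of a node whose states already agree.\<close>

lemma same_edge_functions_if_sinks_agree:
  assumes f: "f \<in> edge_families E F_ZNL" and g: "g \<in> edge_families E F_ZNL"
    and sinks: "\<And>i a t. i \<in> sinks V E \<Longrightarrow> 0 \<le> t \<Longrightarrow> X f a i t = X g a i t"
  shows "same_edge_functions E f g"
proof -
  have all: "j \<in> V \<longrightarrow> (\<forall>a. \<forall>t\<ge>0. X f a j t = X g a j t)" for j
    using finite_acyclic_wf[OF finite_E acyclic]
  proof (induction j rule: wf_induct_rule)
    case (less j)
    show ?case
    proof (cases "j \<in> sinks V E")
      case True
      thus ?thesis using sinks by blast
    next
      case False
      show ?thesis
      proof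
        assume "j \<in> V"
        then obtain i where i: "(i, j) \<in> E" using False by (auto simp: sinks_def)
        hence iV: "i \<in> V" and ji: "j \<in> in_neighbors E i"
          using E_subset by (auto simp: in_neighbors_def)
        have "X f a i t = X g a i t" if "0 \<le> t" for a t
          using less.IH[OF i] iV that by blast
        with identify_in_neighbors[OF f g iV] ji
        show "\<forall>a. \<forall>t\<ge>0. X f a j t = X g a j t" by blast
      qed
    qed
  qed
  show ?thesis
    unfolding same_edge_functions_def
  proof clarify
    fix i j assume ij: "(i, j) \<in> E"
    hence i: "i \<in> V" and ji: "j \<in> in_neighbors E i"
      using E_subset by (auto simp: in_neighbors_def)
    with all identify_in_neighbors[OF f g i] show "f i j = g i j" by blast
  qed
qed

end

section \<open>Necessity of measuring every sink\<close>

lemma weakly_connected_sink_has_in_neighbor: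
  assumes "E \<subseteq> V \<times> V" "E \<noteq> {}" "weakly_connected V E" "s \<in> sinks V E"
  obtains j where "(s, j) \<in> E"
proof -
  have s: "s \<in> V" "\<And>i. (i, s) \<notin> E" using assms(4) by (auto simp: sinks_def)
  \<comment> \<open>The tail \<open>l\<close> of an edge differs from the sink \<open>s\<close>, so
    an undirected walk from \<open>s\<close> to \<open>l\<close> has a first edge, which must enter
    \<open>s\<close>.\<close>
  obtain k l where kl: "(k, l) \<in> E" using assms(2) by auto
  hence "l \<in> V" "l \<noteq> s" using assms(1) s by auto
  hence "(s, l) \<in> (E \<union> E\<inverse>)\<^sup>*" "s \<noteq> l" using assms(3) s by (auto simp: weakly_connected_def)
  then obtain j where "(s, j) \<in> E \<union> E\<inverse>" by (metis converse_rtranclE)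
  thus ?thesis using that s by blast
qed

text \<open>Families differing only on edges into an unmeasured sink give equal measurements, since
  a sink feeds no node.\<close>

lemma identifiable_imp_sinks_measured:
  assumes V: "finite V" "E \<subseteq> V \<times> V" "acyclic E" and "E \<noteq> {}" "weakly_connected V E"
    and U: "admissible_signals U" and M: "M \<subseteq> V" and ident: "identifiable V E U F_ZNL M"
  shows "sinks V E \<subseteq> M"
proof (rule ccontr)
  assume "\<not> sinks V E \<subseteq> M"
  then obtain s where s: "s \<in> sinks V E" "s \<notin> M" by blast
  obtain j where j: "(s, j) \<in> E"
    using weakly_connected_sink_has_in_neighbor assms s by metis
  define f where "f = (\<lambda>(i::nat) (k::nat) (x::real). 1 * x ^ 2)"
  define g where "g = (\<lambda>(i::nat) (k::nat) (x::real). (if i = s then 2 else 1) * x ^ 2)"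
  have f: "f \<in> edge_families E F_ZNL" and g: "g \<in> edge_families E F_ZNL"
    unfolding edge_families_def f_def g_def
    using F_ZNL_scaled_square[of 1] F_ZNL_scaled_square[of 2] by auto
  have "same_measurements V E U M f g"
    unfolding same_measurements_def
  proof (intro ballI allI impI)
    fix i x0 and u :: "nat \<Rightarrow> real \<Rightarrow> real" and t :: real
    assume i: "i \<in> M" and u: "\<forall>k\<in>V. u k \<in> U" and t: "0 \<le> t"
    have ex: "\<exists>x. is_solution V E h x0 u x" if "h \<in> edge_families E F_ZNL" for h
    proof (rule dag_solution_exists[OF V])
      show "\<forall>(i, j)\<in>E. continuous_on UNIV (h i j)"
        using edge_families_memD[OF that] F_ZNL_continuous by blast
      show "\<forall>i\<in>V. locally_integrable (u i)"
        using u U by (auto simp: admissible_signals_def)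
    qed
    obtain x y where x: "is_solution V E f x0 u x" and y: "is_solution V E g x0 u y"
      using ex f g by blast
    have "x i t = y i t"
      by (rule solutions_agree_on_closed_set[OF V x y, of "- {s}"])
         (use s i M t in \<open>auto simp: sinks_def f_def g_def\<close>)
    thus "node_state V E f i x0 u t = node_state V E g i x0 u t"
      using node_state_eq[OF V x] node_state_eq[OF V y] i M t by auto
  qed
  hence "f s j = g s j"
    using ident f g j unfolding identifiable_def same_edge_functions_def by blast
  from fun_cong[OF this, of 1] show False by (simp add: f_def g_def)
qed

section \<open>Sufficiency of restricted data and the equivalence\<close>

theorem theorem2:
  fixes n :: nat and V M :: "nat set" and E :: "(nat \<times> nat) set" and U :: "(real \<Rightarrow> real) set"
  assumes "V = {1..n}" and "E \<subseteq> V \<times> V" and "E \<noteq> {}"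
    and "weakly_connected V E" and "acyclic E"
    and "admissible_signals U"
    and "M \<subseteq> V"
  shows "(identifiable V E U F_ZNL M \<longleftrightarrow> sinks V E \<subseteq> M) \<and>
    (sinks V E \<subseteq> M \<longrightarrow>
      (\<forall>f\<in>edge_families E F_ZNL. \<forall>g\<in>edge_families E F_ZNL.
        ((\<forall>i\<in>M. \<forall>c :: nat \<Rightarrow> real. \<forall>t\<ge>0.
            node_state V E f i (\<lambda>k. 0) (\<lambda>k s. c k) t = node_state V E g i (\<lambda>k. 0) (\<lambda>k s. c k) t)
          \<longrightarrow> same_edge_functions E f g) \<and>
        ((\<forall>i\<in>M. \<forall>x0. \<forall>t\<ge>0.
            node_state V E f i x0 (\<lambda>k s. 0) t = node_state V E g i x0 (\<lambda>k s. 0) t)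
          \<longrightarrow> same_edge_functions E f g)))"
proof -
  have V: "finite V" using assms(1) by simp
  interpret excited: probed_dag V E 0 1
    using V assms by unfold_locales auto
  interpret initial: probed_dag V E 1 0
    using V assms by unfold_locales auto
  have excited: "same_edge_functions E f g"
    if "sinks V E \<subseteq> M" "f \<in> edge_families E F_ZNL" "g \<in> edge_families E F_ZNL"
      and "\<forall>i\<in>M. \<forall>c :: nat \<Rightarrow> real. \<forall>t\<ge>0.
            node_state V E f i (\<lambda>k. 0) (\<lambda>k s. c k) t = node_state V E g i (\<lambda>k. 0) (\<lambda>k s. c k) t"
    for f g
    by (rule excited.same_edge_functions_if_sinks_agree)
       (use that in \<open>auto simp: probed_state_def\<close>)
  have initial: "same_edge_functions E f g"
    if "sinks V E \<subseteq> M" "f \<in> edge_families E F_ZNL" "g \<in> edge_families E F_ZNL"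
      and "\<forall>i\<in>M. \<forall>x0. \<forall>t\<ge>0.
            node_state V E f i x0 (\<lambda>k s. 0) t = node_state V E g i x0 (\<lambda>k s. 0) t"
    for f g
    by (rule initial.same_edge_functions_if_sinks_agree)
       (use that in \<open>auto simp: probed_state_def\<close>)
  have "identifiable V E U F_ZNL M" if "sinks V E \<subseteq> M"
    unfolding identifiable_def
  proof (intro ballI impI)
    fix f g assume fg: "f \<in> edge_families E F_ZNL" "g \<in> edge_families E F_ZNL"
      and same: "same_measurements V E U M f g"
    \<comment> \<open>Constant signals are admissible, so full measurements include the
      constant-excitation data.\<close>
    have "\<forall>k\<in>V. (\<lambda>s. c k) \<in> U" for c :: "nat \<Rightarrow> real"
      using assms(6) by (simp add: admissible_signals_def)
    with same show "same_edge_functions E f g"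
      by (intro excited that fg) (simp add: same_measurements_def)
  qed
  moreover have "sinks V E \<subseteq> M" if "identifiable V E U F_ZNL M"
    using identifiable_imp_sinks_measured[OF V assms(2,5,3,4,6,7) that] .
  ultimately show ?thesis using excited initial by blast
qed

end
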